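(* Let $X$ be a one-step shift of finite type, let $Y$ be an irreducible sofic shift, and let $\pi:X\to Y$ be a finite-to-one one-block factor code with degree $d_\pi$. Let $G$ and $G'$ be the finite directed graphs on the vertex set $\mathcal V=\bigcup_{b\in\mathcal A(Y)}\mathscr P(\pi_{\mathrm b}^{-1}(b))$ defined in the context, let $\mathcal U=\{\pi_{\mathrm b}^{-1}(b): b\in\mathcal A(Y)\}$, and let $$S=\{A\in\mathcal V:\text{ there is a finite path in } G \text{ from } B \text{ to } A \text{ for some } B\in\mathcal U\},$$ $$S'=\{A\in\mathcal V:\text{ there is a finite path in } G' \text{ from } A \text{ to } B \text{ for some } B\in\mathcal U\}.$$ Then $$d_\pi=\min\{|A\cap A'| : A\in S,\ A'\in S',\ A\cap A'\neq\emptyset\}.$$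
   Context: All shift spaces are one-dimensional (two-sided) over finite alphabets. $\mathcal A(X)$ and $\mathcal A(Y)$ denote the alphabets of $X$ and $Y$ (the sets of symbols occurring in their points). A block of a shift space is a finite word occurring in some point of it. A shift of finite type $X$ is one-step if it consists of all bi-infinite sequences all of whose two-letter subwords belong to some fixed set of allowed two-letter words. A factor code is a continuous shift-commuting surjective map. It is one-block if it is induced by a symbol map $\pi_{\mathrm b}:\mathcal A(X)\to\mathcal A(Y)$, i.e. $\pi(x)_i=\pi_{\mathrm b}(x_i)$ for all $i\in\mathbb Z$. It is finite-to-one if every point of $Y$ has finitely many preimages. For $b\in\mathcal A(Y)$, $\pi_{\mathrm b}^{-1}(b)=\{a\in\mathcal A(X):\pi_{\mathrm b}(a)=b\}$, and $\mathscr P(\cdot)$ denotes the power set. Degree: for a finite-to-one factor code $\pi:X\to Y$, the degree $d_\pi$ is the minimal number of $\pi$-preimages of points of $Y$, i.e. $d_\pi=\min_{y\in Y}|\pi^{-1}(y)|$. Graphs: $G$ and $G'$ both have vertex set $\mathcal V=\bigcup_{b\in\mathcal A(Y)}\mathscr P(\pi_{\mathrm b}^{-1}(b))$. Let $A,A'\in\mathcal V$, with $A\subseteq\pi_{\mathrm b}^{-1}(b)$ and $A'\subseteq\pi_{\mathrm b}^{-1}(b')$ for some $b,b'\in\mathcal A(Y)$. In $G$ there is an edge from $A$ to $A'$ if and only if (1) $bb'$ is a block of $Y$, and (2) $A'$ is exactly the set of all symbols $a'\in\pi_{\mathrm b}^{-1}(b')$ such that $aa'$ is a block of $X$ for some $a\in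 A$. In $G'$ there is an edge from $A$ to $A'$ if and only if (1) $bb'$ is a block of $Y$, and (2) $A$ is exactly the set of all symbols $a\in\pi_{\mathrm b}^{-1}(b)$ such that $aa'$ is a block of $X$ for some $a'\in A'$. Finite paths may have length zero (a single vertex), so $\mathcal U\subseteq S$ and $\mathcal U\subseteq S'$. *)

theory Defs
  imports "HOL-Analysis.Function_Topology"
begin

type_synonym 'a config = "int \<Rightarrow> 'a"

definition config_topology :: "'a config topology" where
  "config_topology = product_topology (\<lambda>_::int. discrete_topology (UNIV :: 'a set)) UNIV"

definition shift :: "'a config \<Rightarrow> 'a config" where
  "shift x = (\<lambda>i. x (i + 1))"

text \<open>The symbols that actually occur in points of \<open>X\<close>, not an ambient alphabet.\<close>

definition alphabet :: "'a config set \<Rightarrow> 'a set" where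
  "alphabet X = (\<Union>x\<in>X. range x)"

definition occurs_in :: "'a list \<Rightarrow> 'a config \<Rightarrow> bool" where
  "occurs_in w x \<longleftrightarrow> (\<exists>i. \<forall>k<length w. x (i + int k) = w ! k)"

definition blocks :: "'a config set \<Rightarrow> 'a list set" where
  "blocks X = {w. \<exists>x\<in>X. occurs_in w x}"

text \<open>The type \<open>'a\<close> may be infinite; since the alphabet of \<open>X\<close> is required to be finite,
  being closed in \<open>config_topology\<close> is the same as being closed in the full shift over any
  finite set of symbols containing that alphabet.\<close>

definition shift_space :: "'a config set \<Rightarrow> bool" where
  "shift_space X \<longleftrightarrow> finite (alphabet X) \<and> closedin config_topology X \<and> shift ` X = X"

definition shift_of_finite_type :: "'a config set \<Rightarrow> bool" where
  "shift_of_finite_type X \<longleftrightarrow>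
     (\<exists>\<Sigma> F. finite \<Sigma> \<and> finite F \<and> X = {x. range x \<subseteq> \<Sigma> \<and> (\<forall>w\<in>F. \<not> occurs_in w x)})"

definition one_step :: "'a config set \<Rightarrow> bool" where
  "one_step X \<longleftrightarrow>
     (\<exists>W. (\<forall>w\<in>W. length w = 2) \<and> X = {x. \<forall>i. [x i, x (i + 1)] \<in> W})"

text \<open>A code is given by a function on all configurations, of which only the values on \<open>X\<close>
  matter.\<close>

definition factor_code :: "('a config \<Rightarrow> 'b config) \<Rightarrow> 'a config set \<Rightarrow> 'b config set \<Rightarrow> bool" where
  "factor_code \<pi> X Y \<longleftrightarrow>
     continuous_map (subtopology config_topology X) (subtopology config_topology Y) \<pi> \<and>
     (\<forall>x\<in>X. \<pi> (shift x) = shift (\<pi> x)) \<and> \<pi> ` X = Y"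

definition one_block_code :: "('a \<Rightarrow> 'b) \<Rightarrow> ('a config \<Rightarrow> 'b config) \<Rightarrow> 'a config set \<Rightarrow> bool" where
  "one_block_code \<pi>b \<pi> X \<longleftrightarrow> (\<forall>x\<in>X. \<forall>i. \<pi> x i = \<pi>b (x i))"

text \<open>The covering shift may be taken over \<open>nat\<close>, into which every finite alphabet embeds.\<close>

definition sofic :: "'b config set \<Rightarrow> bool" where
  "sofic Y \<longleftrightarrow>
     shift_space Y \<and>
     (\<exists>(Z :: nat config set) \<phi>. shift_of_finite_type Z \<and> factor_code \<phi> Z Y)"

definition irreducible_shift :: "'b config set \<Rightarrow> bool" where
  "irreducible_shift Y \<longleftrightarrow> (\<forall>u\<in>blocks Y. \<forall>v\<in>blocks Y. \<exists>w. u @ w @ v \<in> blocks Y)"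

definition point_fibre :: "('a config \<Rightarrow> 'b config) \<Rightarrow> 'a config set \<Rightarrow> 'b config \<Rightarrow> 'a config set" where
  "point_fibre \<pi> X y = {x \<in> X. \<pi> x = y}"

definition finite_to_one :: "('a config \<Rightarrow> 'b config) \<Rightarrow> 'a config set \<Rightarrow> 'b config set \<Rightarrow> bool" where
  "finite_to_one \<pi> X Y \<longleftrightarrow> (\<forall>y\<in>Y. finite (point_fibre \<pi> X y))"

text \<open>Only meaningful for finite-to-one codes, since infinite sets have \<open>card\<close> 0.
  On \<open>nat\<close>, \<open>Inf\<close> of a nonempty set is its least element, so this is a minimum.
  \<open>Inf\<close> rather than \<open>Min\<close>, as the set of fibre cardinalities is not known
  to be finite a priori.\<close>

definition degree :: "('a config \<Rightarrow> 'b config) \<Rightarrow> 'a config set \<Rightarrow> 'b config set \<Rightarrow> nat" where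
  "degree \<pi> X Y = Inf ((\<lambda>y. card (point_fibre \<pi> X y)) ` Y)"

definition symbol_fibre :: "('a \<Rightarrow> 'b) \<Rightarrow> 'a config set \<Rightarrow> 'b \<Rightarrow> 'a set" where
  "symbol_fibre \<pi>b X b = {a \<in> alphabet X. \<pi>b a = b}"

definition graph_verts :: "('a \<Rightarrow> 'b) \<Rightarrow> 'a config set \<Rightarrow> 'b config set \<Rightarrow> 'a set set" where
  "graph_verts \<pi>b X Y = (\<Union>b\<in>alphabet Y. Pow (symbol_fibre \<pi>b X b))"

text \<open>The two graphs on \<open>graph_verts\<close>, given by their edge relations. A nonempty vertex lies over a
  unique symbol \<open>b\<close>; the empty vertex lies over every symbol, and an edge at it is
  witnessed by any suitable choice.\<close>

definition forward_graph :: "('a \<Rightarrow> 'b) \<Rightarrow> 'a config set \<Rightarrow> 'b config set \<Rightarrow> 'a set rel" where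
  "forward_graph \<pi>b X Y =
     {(A, A'). \<exists>b\<in>alphabet Y. \<exists>b'\<in>alphabet Y.
        A \<subseteq> symbol_fibre \<pi>b X b \<and> A' \<subseteq> symbol_fibre \<pi>b X b' \<and>
        [b, b'] \<in> blocks Y \<and>
        A' = {a' \<in> symbol_fibre \<pi>b X b'. \<exists>a\<in>A. [a, a'] \<in> blocks X}}"

definition backward_graph :: "('a \<Rightarrow> 'b) \<Rightarrow> 'a config set \<Rightarrow> 'b config set \<Rightarrow> 'a set rel" where
  "backward_graph \<pi>b X Y =
     {(A, A'). \<exists>b\<in>alphabet Y. \<exists>b'\<in>alphabet Y.
        A \<subseteq> symbol_fibre \<pi>b X b \<and> A' \<subseteq> symbol_fibre \<pi>b X b' \<and>
        [b, b'] \<in> blocks Y \<and>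
        A = {a \<in> symbol_fibre \<pi>b X b. \<exists>a'\<in>A'. [a, a'] \<in> blocks X}}"

definition full_fibres :: "('a \<Rightarrow> 'b) \<Rightarrow> 'a config set \<Rightarrow> 'b config set \<Rightarrow> 'a set set" where
  "full_fibres \<pi>b X Y = symbol_fibre \<pi>b X ` alphabet Y"

definition forward_reachable :: "('a \<Rightarrow> 'b) \<Rightarrow> 'a config set \<Rightarrow> 'b config set \<Rightarrow> 'a set set" where
  "forward_reachable \<pi>b X Y =
     {A \<in> graph_verts \<pi>b X Y. \<exists>B\<in>full_fibres \<pi>b X Y. (B, A) \<in> (forward_graph \<pi>b X Y)\<^sup>*}"

definition backward_reachable :: "('a \<Rightarrow> 'b) \<Rightarrow> 'a config set \<Rightarrow> 'b config set \<Rightarrow> 'a set set" where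
  "backward_reachable \<pi>b X Y =
     {A \<in> graph_verts \<pi>b X Y. \<exists>B\<in>full_fibres \<pi>b X Y. (A, B) \<in> (backward_graph \<pi>b X Y)\<^sup>*}"

end

theory Submission
  imports Defs
begin

text \<open>
  Write \<open>f\<close> for the symbol map, so that \<open>Y\<close> is the image of \<open>X\<close> under \<open>x \<mapsto> f \<circ> x\<close>. The idea is
  that both sides of the formula count symbols seen at a fixed coordinate of lifts: the right-hand
  side counts them for lifts of a finite stretch of a point of \<open>Y\<close>, the degree for lifts of a
  whole point.

  Reading a path in the forward graph that starts at a full fibre amounts to collecting the last
  symbols of all lifts of the word it spells, and dually for the backward graph. If the two
  vertices meet, the words can be joined at the common symbol because \<open>X\<close> is one-step. Hence the
  nonempty sets \<open>A \<inter> A'\<close> are precisely the sets of symbols at coordinate \<open>0\<close> in points of \<open>X\<close> whose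
  image agrees with some \<open>y \<in> Y\<close> on a window \<open>[-m, n]\<close>
  (\<open>reachable_intersections_eq\<close>). Let \<open>d\<close> be the least size of such a set.

  Every fibre has at least \<open>d\<close> points: by compactness, for a large enough window around \<open>0\<close> each
  symbol seen through the window comes from a lift of all of \<open>y\<close>
  (\<open>window_symbols_le_fibre\<close>).

  Some fibre has at most \<open>d\<close> points (\<open>fibre_le_smallest_window\<close>). Let \<open>D\<close> be a set of size \<open>d\<close>,
  seen through a window with word \<open>w\<close>. Irreducibility gives a block \<open>w u w\<close> of \<open>Y\<close>. The symbols
  that its lifts show at the first marked position lie in \<open>D\<close>, and by minimality exhaust \<open>D\<close>;
  the symbols at the second marked position again lie in \<open>D\<close>. So from every symbol of \<open>D\<close> a path
  over \<open>w u\<close> leads back into \<open>D\<close>, and chaining such paths yields a point of \<open>X\<close> over the periodic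
  point \<open>y = \<dots> w u w u \<dots>\<close>. The fibre of \<open>y\<close> is finite and translation by the period
  maps it injectively into itself, so all its points are periodic. Two of them that agree at the
  marked position can be glued there to a third, which, being periodic as well, equals both. Hence
  the symbol at the marked position embeds the fibre of \<open>y\<close> into \<open>D\<close>. This last argument takes
  the place of the usual absence of diamonds, which can fail when \<open>X\<close> is reducible.
\<close>

section \<open>One-step shifts\<close>

definition translate :: "int \<Rightarrow> 'a config \<Rightarrow> 'a config" where
  "translate k x = (\<lambda>j. x (j + k))"

definition reflect :: "'a config \<Rightarrow> 'a config" where
  "reflect x = (\<lambda>j. x (- j))"

definition glue :: "'a config \<Rightarrow> 'a config \<Rightarrow> 'a config" where
  "glue x z = (\<lambda>j. if j \<le> 0 then x j else z j)"

lemma one_step_translate: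
  assumes "one_step X" "x \<in> X"
  shows "translate k x \<in> X"
proof -
  obtain W where W: "X = {x. \<forall>i. [x i, x (i + 1)] \<in> W}"
    using assms(1) unfolding one_step_def by blast
  have "[x (i + k), x (i + 1 + k)] \<in> W" for i
  proof -
    have "[x (i + k), x ((i + k) + 1)] \<in> W" using assms(2) W by blast
    then show ?thesis by (simp add: algebra_simps)
  qed
  then show ?thesis by (simp add: W translate_def)
qed

text \<open>
  The Markov property: in a one-step shift the past and the future of a point constrain each
  other only through the present symbol.
\<close>

lemma one_step_glue:
  assumes "one_step X" "x \<in> X" "z \<in> X" "x 0 = z 0"
  shows "glue x z \<in> X"
proof -
  obtain W where W: "X = {x. \<forall>i. [x i, x (i + 1)] \<in> W}"
    using assms(1) unfolding one_step_def by blast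
  have "[glue x z i, glue x z (i + 1)] \<in> W" for i
  proof -
    consider "i < 0" | "i = 0" | "i > 0" by linarith
    then show ?thesis
      using assms(2-4) W by cases (auto simp: glue_def dest: spec[of _ i])
  qed
  then show ?thesis by (simp add: W)
qed

lemma one_step_reflect:
  assumes "one_step X"
  shows "one_step (reflect ` X)"
proof -
  obtain W where W: "\<forall>w\<in>W. length w = 2" "X = {x. \<forall>i. [x i, x (i + 1)] \<in> W}"
    using assms unfolding one_step_def by blast
  have "reflect ` X = {x. \<forall>i. [x i, x (i + 1)] \<in> rev ` W}"
  proof (intro equalityI subsetI)
    fix z assume "z \<in> reflect ` X"
    then obtain x where x: "x \<in> X" "z = reflect x" by blast
    have "[z i, z (i + 1)] \<in> rev ` W" for i
    proof -
      have "[x (- i - 1), x (- i - 1 + 1)] \<in> W" using x W by blast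
      then have "rev [x (- i - 1), x (- i)] \<in> rev ` W" by (intro imageI) simp
      then show ?thesis by (simp add: x reflect_def)
    qed
    then show "z \<in> {x. \<forall>i. [x i, x (i + 1)] \<in> rev ` W}" by blast
  next
    fix z :: "'a config" assume z: "z \<in> {x. \<forall>i. [x i, x (i + 1)] \<in> rev ` W}"
    have "[z (- i), z (- (i + 1))] \<in> W" for i
    proof -
      have "[z (- i - 1), z (- i - 1 + 1)] \<in> rev ` W" using z by blast
      then obtain w where "w \<in> W" "[z (- i - 1), z (- i)] = rev w" by auto
      then have "rev [z (- i - 1), z (- i)] \<in> W" by (simp only: rev_rev_ident)
      then show ?thesis by simp
    qed
    then have "reflect z \<in> X" by (simp add: W reflect_def)
    moreover have "z = reflect (reflect z)" by (simp add: reflect_def)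
    ultimately show "z \<in> reflect ` X" by blast
  qed
  moreover have "\<forall>w\<in>rev ` W. length w = 2" using W(1) by simp
  ultimately show ?thesis unfolding one_step_def by blast
qed

lemma in_blocks_iff:
  assumes "\<forall>x\<in>X. \<forall>k. translate k x \<in> X"
  shows "w \<in> blocks X \<longleftrightarrow> (\<exists>x\<in>X. \<forall>k<length w. x (int k) = w ! k)"
proof
  assume "w \<in> blocks X"
  then obtain x i where "x \<in> X" "\<forall>k<length w. x (i + int k) = w ! k"
    unfolding blocks_def occurs_in_def by blast
  then have "\<forall>k<length w. translate i x (int k) = w ! k"
    by (simp add: translate_def add.commute)
  then show "\<exists>x\<in>X. \<forall>k<length w. x (int k) = w ! k" using assms \<open>x \<in> X\<close> by blast
next
  assume "\<exists>x\<in>X. \<forall>k<length w. x (int k) = w ! k"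
  then show "w \<in> blocks X"
    unfolding blocks_def occurs_in_def by (auto intro!: bexI exI[of _ 0])
qed

lemma pair_in_blocks_iff:
  assumes "\<forall>x\<in>X. \<forall>k. translate k x \<in> X"
  shows "[a, b] \<in> blocks X \<longleftrightarrow> (\<exists>x\<in>X. x 0 = a \<and> x 1 = b)"
proof -
  have "(\<forall>k<length [a, b]. x (int k) = [a, b] ! k) \<longleftrightarrow> x 0 = a \<and> x 1 = b"
      for x :: "'a config"
    by (simp add: less_Suc_eq all_conj_distrib)
  then show ?thesis unfolding in_blocks_iff[OF assms] by blast
qed

lemma translate_in_image:
  assumes "one_step X" "y \<in> (\<circ>) f ` X"
  shows "translate k y \<in> (\<circ>) f ` X"
proof -
  obtain x where "x \<in> X" "y = f \<circ> x" using assms(2) by blast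
  then have "translate k y = f \<circ> translate k x" by (simp add: translate_def fun_eq_iff)
  then show ?thesis using one_step_translate[OF assms(1) \<open>x \<in> X\<close>] by blast
qed

lemma symbol_at_0:
  assumes "\<forall>x\<in>X. \<forall>k. translate k x \<in> X" "a \<in> alphabet X"
  obtains x where "x \<in> X" "x 0 = a"
proof -
  obtain x i where "x \<in> X" "x i = a" using assms(2) unfolding alphabet_def by blast
  then have "translate i x \<in> X" "translate i x 0 = a" using assms(1) by (auto simp: translate_def)
  then show ?thesis using that by blast
qed

section \<open>Symbols seen through a window\<close>

definition window_symbols ::
    "('a \<Rightarrow> 'b) \<Rightarrow> 'a config set \<Rightarrow> 'b config \<Rightarrow> nat \<Rightarrow> nat \<Rightarrow> 'a set" where
  "window_symbols f X y m n =
     {x 0 | x. x \<in> X \<and> (\<forall>j. - int m \<le> j \<and> j \<le> int n \<longrightarrow> f (x j) = y j)}"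

lemma window_symbols_cong:
  assumes "\<And>j. - int m \<le> j \<Longrightarrow> j \<le> int n \<Longrightarrow> y j = y' j"
  shows "window_symbols f X y m n = window_symbols f X y' m n"
proof -
  have "(\<forall>j. - int m \<le> j \<and> j \<le> int n \<longrightarrow> f (x j) = y j) \<longleftrightarrow>
      (\<forall>j. - int m \<le> j \<and> j \<le> int n \<longrightarrow> f (x j) = y' j)" for x
    using assms by auto
  then show ?thesis unfolding window_symbols_def by simp
qed

lemma window_symbols_antimono:
  assumes "m \<le> m'" "n \<le> n'"
  shows "window_symbols f X y m' n' \<subseteq> window_symbols f X y m n"
  using assms unfolding window_symbols_def by fastforce

lemma finite_window_symbols:
  assumes "finite (alphabet X)"
  shows "finite (window_symbols f X y m n)"
  by (rule finite_subset[OF _ assms]) (auto simp: window_symbols_def alphabet_def)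

lemma window_symbols_nonempty:
  assumes "y \<in> (\<circ>) f ` X"
  shows "window_symbols f X y m n \<noteq> {}"
  using assms unfolding window_symbols_def by auto

text \<open>
  A lift of the left half of the window and a lift of the right half that show the same symbol at
  \<open>0\<close> can be glued there.
\<close>

lemma window_symbols_Int:
  assumes "one_step X"
  shows "window_symbols f X y m 0 \<inter> window_symbols f X y 0 n = window_symbols f X y m n"
proof (intro equalityI subsetI)
  fix a assume a: "a \<in> window_symbols f X y m 0 \<inter> window_symbols f X y 0 n"
  obtain x where x: "x \<in> X" "x 0 = a" "\<And>j. - int m \<le> j \<Longrightarrow> j \<le> 0 \<Longrightarrow> f (x j) = y j"
    using a unfolding window_symbols_def by auto
  obtain z where z: "z \<in> X" "z 0 = a" "\<And>j. 0 \<le> j \<Longrightarrow> j \<le> int n \<Longrightarrow> f (z j) = y j"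
    using a unfolding window_symbols_def by auto
  have "glue x z \<in> X" using one_step_glue[OF assms x(1) z(1)] x(2) z(2) by simp
  moreover have "glue x z 0 = a" by (simp add: glue_def x)
  moreover have "f (glue x z j) = y j" if "- int m \<le> j" "j \<le> int n" for j
    using x z that by (auto simp: glue_def)
  ultimately show "a \<in> window_symbols f X y m n" unfolding window_symbols_def by blast
next
  fix a assume "a \<in> window_symbols f X y m n"
  then show "a \<in> window_symbols f X y m 0 \<inter> window_symbols f X y 0 n"
    using window_symbols_antimono[of m m 0 n f X y] window_symbols_antimono[of 0 m n n f X y]
    by auto
qed

lemma window_symbols_reflect:
  "window_symbols f (reflect ` X) y m n = window_symbols f X (reflect y) n m"
proof -
  have eq: "(\<forall>j. - int m \<le> j \<and> j \<le> int n \<longrightarrow> f (x (- j)) = y j) \<longleftrightarrow>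
      (\<forall>j. - int n \<le> j \<and> j \<le> int m \<longrightarrow> f (x j) = y (- j))" for x
  proof (intro iffI allI impI)
    fix j assume "\<forall>j. - int m \<le> j \<and> j \<le> int n \<longrightarrow> f (x (- j)) = y j" "- int n \<le> j \<and> j \<le> int m"
    then show "f (x j) = y (- j)" by (auto dest: spec[of _ "- j"])
  next
    fix j assume "\<forall>j. - int n \<le> j \<and> j \<le> int m \<longrightarrow> f (x j) = y (- j)" "- int m \<le> j \<and> j \<le> int n"
    then show "f (x (- j)) = y j" by (auto dest: spec[of _ "- j"])
  qed
  have "window_symbols f (reflect ` X) y m n =
      {reflect x 0 | x. x \<in> X \<and> (\<forall>j. - int m \<le> j \<and> j \<le> int n \<longrightarrow> f (reflect x j) = y j)}"
    unfolding window_symbols_def by blast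
  also have "\<dots> = window_symbols f X (reflect y) n m"
    unfolding window_symbols_def reflect_def eq by simp
  finally show ?thesis .
qed

section \<open>Reachable vertices\<close>

lemma symbol_fibre_eq_window_symbols:
  assumes "one_step X"
  shows "symbol_fibre f X b = window_symbols f X (\<lambda>_. b) 0 0"
proof (intro equalityI subsetI)
  fix a assume a: "a \<in> symbol_fibre f X b"
  obtain x where "x \<in> X" "x 0 = a"
    using a symbol_at_0[of X a] one_step_translate[OF assms] unfolding symbol_fibre_def by blast
  then show "a \<in> window_symbols f X (\<lambda>_. b) 0 0"
    using a unfolding window_symbols_def symbol_fibre_def by auto
qed (auto simp: window_symbols_def symbol_fibre_def alphabet_def)

text \<open>
  One step in the forward graph lengthens the word by one letter on the right. As windows are
  anchored at coordinate \<open>0\<close>, the old word is moved one place to the left. The sequence \<open>v\<close> is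
  arbitrary because a path in the graph may spell a word that is not a block of \<open>Y\<close>; such a path
  ends at the empty vertex.
\<close>

lemma successors_window_symbols:
  assumes "one_step X"
  shows "{a' \<in> symbol_fibre f X b. \<exists>a\<in>window_symbols f X v n 0. [a, a'] \<in> blocks X} =
    window_symbols f X (\<lambda>j. if j < 0 then v (j + 1) else b) (Suc n) 0"
    (is "?L = window_symbols f X ?v _ _")
proof (intro equalityI subsetI)
  note tr = one_step_translate[OF assms]
  have inv: "\<forall>x\<in>X. \<forall>k. translate k x \<in> X" using tr by blast
  fix a' assume "a' \<in> ?L"
  then obtain a where a': "f a' = b" and a: "a \<in> window_symbols f X v n 0" "[a, a'] \<in> blocks X"
    unfolding symbol_fibre_def by blast
  obtain x where x: "x \<in> X" "x 0 = a" "\<And>j. - int n \<le> j \<Longrightarrow> j \<le> 0 \<Longrightarrow> f (x j) = v j"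
    using a(1) unfolding window_symbols_def by auto
  obtain z where z: "z \<in> X" "z 0 = a" "z 1 = a'" using a(2) pair_in_blocks_iff[OF inv] by blast
  have "translate 1 (glue x z) \<in> X"
    using one_step_glue[OF assms x(1) z(1)] x(2) z(2) tr by simp
  moreover have "translate 1 (glue x z) 0 = a'" by (simp add: translate_def glue_def z)
  moreover have "f (translate 1 (glue x z) j) = ?v j" if "- int (Suc n) \<le> j" "j \<le> int 0" for j
    using x(3)[of "j + 1"] that z(3) a' by (cases "j = 0") (auto simp: translate_def glue_def)
  ultimately show "a' \<in> window_symbols f X ?v (Suc n) 0" unfolding window_symbols_def by blast
next
  note tr = one_step_translate[OF assms]
  have inv: "\<forall>x\<in>X. \<forall>k. translate k x \<in> X" using tr by blast
  fix a' assume "a' \<in> window_symbols f X ?v (Suc n) 0"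
  then obtain x where x: "x \<in> X" "x 0 = a'"
      "\<And>j. - int (Suc n) \<le> j \<Longrightarrow> j \<le> 0 \<Longrightarrow> f (x j) = ?v j"
    unfolding window_symbols_def by auto
  have "f (translate (- 1) x j) = v j" if "- int n \<le> j" "j \<le> int 0" for j
    using x(3)[of "j - 1"] that by (simp add: translate_def)
  then have "translate (- 1) x 0 \<in> window_symbols f X v n 0"
    using tr[OF x(1)] unfolding window_symbols_def by blast
  moreover have "[translate (- 1) x 0, a'] \<in> blocks X"
    unfolding pair_in_blocks_iff[OF inv] using tr[OF x(1)] x(2)
    by (intro bexI[of _ "translate (- 1) x"]) (simp_all, simp_all add: translate_def)
  moreover have "a' \<in> symbol_fibre f X b"
    using x(1,2) x(3)[of 0] unfolding symbol_fibre_def alphabet_def by auto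
  ultimately show "a' \<in> ?L" by blast
qed

lemma forward_reachable_imp_window_symbols:
  assumes "one_step X" "A \<in> forward_reachable f X Y"
  shows "\<exists>v n. A = window_symbols f X v n 0"
proof -
  obtain b where "(symbol_fibre f X b, A) \<in> (forward_graph f X Y)\<^sup>*"
    using assms(2) unfolding forward_reachable_def full_fibres_def by blast
  then show ?thesis
  proof (induction rule: rtrancl_induct)
    case base
    show ?case by (intro exI) (rule symbol_fibre_eq_window_symbols[OF assms(1)])
  next
    case (step A A')
    then obtain v n where A: "A = window_symbols f X v n 0" by blast
    obtain b' where A': "A' = {a' \<in> symbol_fibre f X b'. \<exists>a\<in>A. [a, a'] \<in> blocks X}"
      using step(2) unfolding forward_graph_def by blast
    show ?case
      by (intro exI) (rule A'[unfolded A successors_window_symbols[OF assms(1)]])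
  qed
qed

lemma window_symbols_forward_reachable:
  assumes "one_step X" "Y = (\<circ>) f ` X" "y \<in> Y"
  shows "window_symbols f X y n 0 \<in> forward_reachable f X Y"
proof -
  have sub: "window_symbols f X y n 0 \<subseteq> symbol_fibre f X (y 0)" for y n
    unfolding window_symbols_def symbol_fibre_def alphabet_def by auto
  have alph: "y j \<in> alphabet Y" if "y \<in> Y" for y j
    using that unfolding alphabet_def by blast
  have tr: "translate k y \<in> Y" if "y \<in> Y" for k y
    using translate_in_image[OF assms(1)] that assms(2) by blast
  have inv: "\<forall>y\<in>Y. \<forall>k. translate k y \<in> Y" using tr by blast
  have "\<exists>B\<in>full_fibres f X Y. (B, window_symbols f X y n 0) \<in> (forward_graph f X Y)\<^sup>*"
    using assms(3)
  proof (induction n arbitrary: y)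
    case 0
    have "window_symbols f X y 0 0 = symbol_fibre f X (y 0)"
      unfolding symbol_fibre_eq_window_symbols[OF assms(1)] by (rule window_symbols_cong) simp
    then show ?case using alph[OF 0] unfolding full_fibres_def by auto
  next
    case (Suc n)
    let ?v = "translate (- 1) y"
    have v: "?v \<in> Y" by (rule tr) fact
    have "window_symbols f X y (Suc n) 0 =
        window_symbols f X (\<lambda>j. if j < 0 then ?v (j + 1) else y 0) (Suc n) 0"
      by (rule window_symbols_cong) (auto simp: translate_def)
    then have eq: "window_symbols f X y (Suc n) 0 =
        {a' \<in> symbol_fibre f X (y 0). \<exists>a\<in>window_symbols f X ?v n 0. [a, a'] \<in> blocks X}"
      by (simp only: successors_window_symbols[OF assms(1)])
    have "[?v 0, y 0] \<in> blocks Y"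
      unfolding pair_in_blocks_iff[OF inv] using v by (intro bexI[of _ ?v]) (auto simp: translate_def)
    then have "(window_symbols f X ?v n 0, window_symbols f X y (Suc n) 0) \<in> forward_graph f X Y"
      using eq sub alph[OF v, of 0] alph[OF Suc.prems, of 0] unfolding forward_graph_def by blast
    then show ?case using Suc.IH[OF v] by (meson rtrancl.rtrancl_into_rtrancl)
  qed
  moreover have "window_symbols f X y n 0 \<in> graph_verts f X Y"
    using sub alph[OF assms(3)] unfolding graph_verts_def by blast
  ultimately show ?thesis unfolding forward_reachable_def by blast
qed

text \<open>
  Reversing time exchanges the two graphs, so the results on the forward graph carry over.
\<close>

lemma backward_reachable_eq_forward_reachable_reflect:
  "backward_reachable f X Y = forward_reachable f (reflect ` X) (reflect ` Y)"
proof -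
  have alph: "alphabet (reflect ` Z) = alphabet Z" for Z :: "'z config set"
    unfolding alphabet_def reflect_def by (auto simp: image_iff) (metis minus_minus)
  have blocks: "[a, b] \<in> blocks (reflect ` Z) \<longleftrightarrow> [b, a] \<in> blocks Z" for Z :: "'z config set" and a b
  proof -
    have "occurs_in [a, b] (reflect x) \<longleftrightarrow> occurs_in [b, a] x" for x :: "'z config"
    proof -
      have "(\<exists>i. x (- i) = a \<and> x (- (i + 1)) = b) \<longleftrightarrow> (\<exists>i. x i = b \<and> x (i + 1) = a)"
      proof
        assume "\<exists>i. x (- i) = a \<and> x (- (i + 1)) = b"
        then obtain i where "x (- i) = a \<and> x (- (i + 1)) = b" by blast
        then show "\<exists>i. x i = b \<and> x (i + 1) = a" by (intro exI[of _ "- (i + 1)"]) simp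
      next
        assume "\<exists>i. x i = b \<and> x (i + 1) = a"
        then obtain i where "x i = b \<and> x (i + 1) = a" by blast
        then show "\<exists>i. x (- i) = a \<and> x (- (i + 1)) = b"
          by (intro exI[of _ "- (i + 1)"]) (simp add: add.commute)
      qed
      then show ?thesis unfolding occurs_in_def reflect_def
        by (simp add: less_Suc_eq all_conj_distrib conj_commute)
    qed
    then show ?thesis unfolding blocks_def by auto
  qed
  have fib: "symbol_fibre f (reflect ` X) = symbol_fibre f X"
    unfolding symbol_fibre_def alph ..
  have "forward_graph f (reflect ` X) (reflect ` Y) = (backward_graph f X Y)\<inverse>"
    unfolding forward_graph_def backward_graph_def fib alph blocks by blast
  then show ?thesis
    unfolding forward_reachable_def backward_reachable_def full_fibres_def graph_verts_def fib alph
    by (simp add: rtrancl_converse)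
qed

lemma backward_reachable_imp_window_symbols:
  assumes "one_step X" "A \<in> backward_reachable f X Y"
  shows "\<exists>v n. A = window_symbols f X v 0 n"
  using forward_reachable_imp_window_symbols[OF one_step_reflect[OF assms(1)]] assms(2)
  unfolding backward_reachable_eq_forward_reachable_reflect window_symbols_reflect by blast

lemma window_symbols_backward_reachable:
  assumes "one_step X" "Y = (\<circ>) f ` X" "y \<in> Y"
  shows "window_symbols f X y 0 n \<in> backward_reachable f X Y"
proof -
  have "reflect ` Y = (\<circ>) f ` reflect ` X"
    unfolding assms(2) image_image reflect_def comp_def ..
  then have "window_symbols f (reflect ` X) (reflect y) n 0
      \<in> forward_reachable f (reflect ` X) (reflect ` Y)"
    using window_symbols_forward_reachable[OF one_step_reflect[OF assms(1)]] assms(3) by blast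
  moreover have "reflect (reflect y) = y" by (simp add: reflect_def)
  ultimately show ?thesis
    by (simp add: backward_reachable_eq_forward_reachable_reflect window_symbols_reflect)
qed

lemma reachable_intersections_eq:
  assumes "one_step X" "Y = (\<circ>) f ` X"
  shows "{card (A \<inter> A') | A A'.
      A \<in> forward_reachable f X Y \<and> A' \<in> backward_reachable f X Y \<and> A \<inter> A' \<noteq> {}} =
    {card (window_symbols f X y m n) | y m n. y \<in> Y}" (is "?L = ?R")
proof (intro equalityI subsetI)
  fix c assume "c \<in> ?L"
  then obtain A A' where c: "c = card (A \<inter> A')" and A: "A \<in> forward_reachable f X Y"
    and A': "A' \<in> backward_reachable f X Y" and ne: "A \<inter> A' \<noteq> {}" by blast
  obtain v m where v: "A = window_symbols f X v m 0"
    using forward_reachable_imp_window_symbols[OF assms(1) A] by blast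
  obtain u n where u: "A' = window_symbols f X u 0 n"
    using backward_reachable_imp_window_symbols[OF assms(1) A'] by blast
  obtain a where a: "a \<in> A" "a \<in> A'" using ne by blast
  obtain x where x: "x \<in> X" "x 0 = a" "\<And>j. - int m \<le> j \<Longrightarrow> j \<le> 0 \<Longrightarrow> f (x j) = v j"
    using a unfolding v window_symbols_def by auto
  obtain z where z: "z \<in> X" "z 0 = a" "\<And>j. 0 \<le> j \<Longrightarrow> j \<le> int n \<Longrightarrow> f (z j) = u j"
    using a unfolding u window_symbols_def by auto
  \<comment> \<open>The vertices only remember words; gluing lifts of these at a common symbol produces one
    point of \<open>Y\<close> that spells both.\<close>
  define y where "y = f \<circ> glue x z"
  have "glue x z \<in> X" using one_step_glue[OF assms(1) x(1) z(1)] x(2) z(2) by simp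
  then have "y \<in> Y" unfolding y_def assms(2) by (rule imageI)
  have "A = window_symbols f X y m 0"
    unfolding v by (rule window_symbols_cong) (simp add: y_def glue_def x(3))
  moreover have "A' = window_symbols f X y 0 n"
    unfolding u
  proof (rule window_symbols_cong)
    fix j assume "- int 0 \<le> j" "j \<le> int n"
    then show "u j = y j"
      using z(3)[of j] x(2) z(2) by (cases "j = 0") (auto simp: y_def glue_def)
  qed
  ultimately have "A \<inter> A' = window_symbols f X y m n"
    by (simp only: window_symbols_Int[OF assms(1)])
  then have "c = card (window_symbols f X y m n)" using c by simp
  then show "c \<in> ?R" using \<open>y \<in> Y\<close> by (intro CollectI exI conjI)
next
  fix c assume "c \<in> ?R"
  then obtain y m n where c: "c = card (window_symbols f X y m n)" and y: "y \<in> Y" by blast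
  have "window_symbols f X y m n \<noteq> {}"
    using window_symbols_nonempty y unfolding assms(2) by blast
  then show "c \<in> ?L"
    unfolding c window_symbols_Int[OF assms(1), of f y m n, symmetric]
    using window_symbols_forward_reachable[OF assms y, of m]
      window_symbols_backward_reachable[OF assms y, of n] by blast
qed

section \<open>Every fibre is at least as large as some window\<close>

text \<open>
  The lifts of longer and longer windows of \<open>y\<close> with the given symbol at \<open>0\<close> form a decreasing
  sequence of nonempty closed subsets of the compact full shift over the alphabet of \<open>X\<close>.
\<close>

lemma compactness_of_lifts:
  fixes X :: "'a config set"
  assumes "one_step X" "finite (alphabet X)"
    and lifts: "\<And>n. a \<in> window_symbols f X y n n"
  shows "\<exists>x\<in>X. f \<circ> x = y \<and> x 0 = a"
proof -
  obtain W where W: "X = {x. \<forall>i. [x i, x (i + 1)] \<in> W}"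
    using assms(1) unfolding one_step_def by blast
  define T where "T = product_topology (\<lambda>_::int. discrete_topology (alphabet X)) UNIV"
  have top: "topspace T = {x. range x \<subseteq> alphabet X}"
    unfolding T_def by (auto simp: PiE_def Pi_def)
  have XT: "X \<subseteq> topspace T" unfolding top alphabet_def by blast
  have "compact_space T"
    unfolding T_def using assms(2) by (simp add: compact_space_product_topology compact_space_discrete_topology)
  have closed1: "closedin T {x \<in> topspace T. P (x i)}" for P i
  proof -
    have "continuous_map T (discrete_topology (alphabet X)) (\<lambda>x. x i)"
      unfolding T_def
      using continuous_map_product_projection[of i UNIV "\<lambda>_. discrete_topology (alphabet X)"] by simp
    then have "closedin T {x \<in> topspace T. x i \<in> {a \<in> alphabet X. P a}}"
      by (rule closedin_continuous_map_preimage) simp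
    moreover have "{x \<in> topspace T. x i \<in> {a \<in> alphabet X. P a}} = {x \<in> topspace T. P (x i)}"
      unfolding top by auto
    ultimately show ?thesis by simp
  qed
  have closed2: "closedin T {x \<in> topspace T. P (x i) (x k)}" for P i k
  proof -
    have "{x \<in> topspace T. P (x i) (x k)} =
        (\<Union>c\<in>alphabet X. {x \<in> topspace T. x i = c} \<inter> {x \<in> topspace T. P c (x k)})"
      unfolding top by auto
    also have "closedin T \<dots>"
      using assms(2) by (intro closedin_Union) (auto intro!: closedin_Int closed1)
    finally show ?thesis .
  qed
  have "X = (\<Inter>i. {x \<in> topspace T. [x i, x (i + 1)] \<in> W})" using XT W by blast
  also have "closedin T \<dots>" by (intro closedin_Inter) (auto intro: closed2)
  finally have closedX: "closedin T X" .
  define K where "K n = {x \<in> X. x 0 = a \<and> (\<forall>j. - int n \<le> j \<and> j \<le> int n \<longrightarrow> f (x j) = y j)}"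
    for n
  have "closedin T (K n)" for n
  proof -
    have "K n = X \<inter> {x \<in> topspace T. x 0 = a} \<inter>
        (\<Inter>j. {x \<in> topspace T. - int n \<le> j \<and> j \<le> int n \<longrightarrow> f (x j) = y j})"
      using XT unfolding K_def by blast
    also have "closedin T \<dots>"
      by (intro closedin_Int closedX closed1 closedin_Inter) (auto intro: closed1)
    finally show ?thesis .
  qed
  moreover have "K n \<noteq> {}" for n
    using lifts[of n] unfolding K_def window_symbols_def by auto
  moreover have "decseq K" unfolding K_def by (rule decseq_SucI) auto
  ultimately have "(\<Inter>n. K n) \<noteq> {}" using \<open>compact_space T\<close> by (intro compact_space_imp_nest)
  then obtain x where x: "\<And>n. x \<in> K n" by blast
  have "f (x j) = y j" for j 
  proof -
    have "- int (nat \<bar>j\<bar>) \<le> j \<and> j \<le> int (nat \<bar>j\<bar>)" by linarith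
    then show ?thesis using x[of "nat \<bar>j\<bar>"] unfolding K_def by blast
  qed
  then show ?thesis using x[of 0] unfolding K_def by (auto simp: fun_eq_iff)
qed

text \<open>
  A symbol that is not at coordinate \<open>0\<close> of any lift of \<open>y\<close> is excluded by some finite window;
  the alphabet being finite, one window excludes them all.
\<close>

lemma window_symbols_le_fibre:
  assumes "one_step X" "finite (alphabet X)" "finite {x \<in> X. f \<circ> x = y}"
  shows "\<exists>n. card (window_symbols f X y n n) \<le> card {x \<in> X. f \<circ> x = y}"
proof -
  let ?F = "{x \<in> X. f \<circ> x = y}"
  have "\<forall>a. \<exists>n. a \<notin> (\<lambda>x. x 0) ` ?F \<longrightarrow> a \<notin> window_symbols f X y n n"
  proof (intro allI)
    fix a
    show "\<exists>n. a \<notin> (\<lambda>x. x 0) ` ?F \<longrightarrow> a \<notin> window_symbols f X y n n"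
      using compactness_of_lifts[OF assms(1,2), of a f y] by blast
  qed
  from choice[OF this] obtain N
    where N: "\<And>a. a \<notin> (\<lambda>x. x 0) ` ?F \<Longrightarrow> a \<notin> window_symbols f X y (N a) (N a)"
    by blast
  obtain M where M: "\<And>a. a \<in> alphabet X \<Longrightarrow> N a \<le> M"
    using finite_imageI[OF assms(2), of N] unfolding finite_nat_set_iff_bounded_le by blast
  have "window_symbols f X y M M \<subseteq> (\<lambda>x. x 0) ` ?F"
  proof
    fix a assume a: "a \<in> window_symbols f X y M M"
    then have "a \<in> alphabet X" unfolding window_symbols_def alphabet_def by auto
    then have "N a \<le> M" by (rule M)
    then have "a \<in> window_symbols f X y (N a) (N a)"
      using a window_symbols_antimono[of "N a" M "N a" M f X y] by blast
    then show "a \<in> (\<lambda>x. x 0) ` ?F" using N by blast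
  qed
  then have "card (window_symbols f X y M M) \<le> card ((\<lambda>x. x 0) ` ?F)"
    using assms(3) by (intro card_mono) auto
  also have "\<dots> \<le> card ?F" using assms(3) by (rule card_image_le)
  finally show ?thesis by blast
qed

section \<open>Some fibre is at most as large as the smallest window\<close>

lemma finite_orbit_repeats:
  assumes "finite D" "f ` D \<subseteq> D" "a \<in> D"
  obtains i k where "k > 0" "(f ^^ (i + k)) a = (f ^^ i) a"
proof -
  have "(f ^^ i) a \<in> D" for i using assms(2,3) by (induction i) auto
  then have "finite (range (\<lambda>i. (f ^^ i) a))" using assms(1) by (meson finite_subset image_subsetI)
  then have "\<not> inj (\<lambda>i. (f ^^ i) a)" using finite_imageD by blast
  then obtain i j where "i < j" "(f ^^ j) a = (f ^^ i) a"
    unfolding inj_def by (metis linorder_neqE_nat)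
  then show ?thesis using that[of "j - i" i] by simp
qed

text \<open>
  A self-map of a finite set need not be onto, but it has a cycle, along which it can be followed
  backwards for ever.
\<close>

lemma two_sided_orbit:
  assumes "finite D" "f ` D \<subseteq> D" "D \<noteq> {}"
  obtains s :: "int \<Rightarrow> 'a" where "range s \<subseteq> D" "\<And>m. s (m + 1) = f (s m)"
proof -
  obtain a where a: "a \<in> D" using assms(3) by blast
  obtain i k where k: "k > 0" "(f ^^ (i + k)) a = (f ^^ i) a"
    using finite_orbit_repeats[OF assms(1,2) a] by blast
  define c where "c = (f ^^ i) a"
  have D: "(f ^^ j) a \<in> D" for j using assms(2) a by (induction j) auto
  have per: "(f ^^ k) c = c" 
    using k(2) unfolding c_def by (metis add.commute comp_apply funpow_add)
  define s where "s m = (f ^^ nat (m mod int k)) c" for m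
  have "range s \<subseteq> D"
  proof -
    have "(f ^^ j) c \<in> D" for j using D[of "j + i"] unfolding c_def by (simp add: funpow_add)
    then show ?thesis unfolding s_def by blast
  qed
  moreover have "s (m + 1) = f (s m)" for m
  proof -
    have f_s: "f (s m) = (f ^^ nat (m mod int k + 1)) c"
      unfolding s_def using k(1) by (simp add: nat_add_distrib)
    show ?thesis
    proof (cases "m mod int k + 1 = int k")
      case True
      then have "(m + 1) mod int k = 0" by (metis mod_add_left_eq mod_self)
      then show ?thesis unfolding f_s True by (simp add: s_def per)
    next
      case False
      then have "0 \<le> m mod int k + 1" "m mod int k + 1 < int k"
        using k(1) pos_mod_sign[of "int k" m] pos_mod_bound[of "int k" m] by linarith+
      then have "(m mod int k + 1) mod int k = m mod int k + 1" by (rule mod_pos_pos_trivial)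
      then have "(m + 1) mod int k = m mod int k + 1" by (simp only: mod_add_left_eq)
      then show ?thesis unfolding f_s by (simp add: s_def)
    qed
  qed
  ultimately show ?thesis using that by blast
qed

text \<open>
  Translation by a period of \<open>y\<close> acts injectively on the fibre of \<open>y\<close>; on a finite fibre every
  orbit is then a cycle.
\<close>

lemma finite_fibre_periodic:
  assumes "one_step X" "finite {x \<in> X. f \<circ> x = y}" "translate p y = y" "p > 0"
    and "x \<in> X" "f \<circ> x = y"
  obtains q where "q > 0" "translate q x = x"
proof -
  let ?F = "{x \<in> X. f \<circ> x = y}"
  have iter: "(translate p ^^ n) z = translate (int n * p) z" for n and z :: "'a config"
    by (induction n) (auto simp: translate_def fun_eq_iff algebra_simps)
  have "translate p z \<in> ?F" if "z \<in> ?F" for z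
  proof -
    have "f \<circ> translate p z = translate p (f \<circ> z)" by (simp add: translate_def fun_eq_iff)
    then show ?thesis using that assms(3) one_step_translate[OF assms(1)] by simp
  qed
  then obtain i k where k: "k > 0" "(translate p ^^ (i + k)) x = (translate p ^^ i) x"
    using finite_orbit_repeats[OF assms(2), of "translate p" x] assms(5,6) by blast
  have "translate (int k * p) x = x"
  proof
    fix j
    have "translate (int (i + k) * p) x (j - int i * p) = translate (int i * p) x (j - int i * p)"
      using k(2) unfolding iter by simp
    then show "translate (int k * p) x j = x j" by (simp add: translate_def algebra_simps)
  qed
  then show ?thesis using that[of "int k * p"] k(1) assms(4) by simp
qed

lemma translate_period_multiple:
  assumes "translate q x = x"
  shows "x (j + t * q) = x j"
proof -
  have step: "x (i + q) = x i" for i using fun_cong[OF assms, of i] by (simp add: translate_def)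
  have nat: "x (i + int n * q) = x i" for i n
  proof (induction n)
    case (Suc n)
    then show ?case using step[of "i + int n * q"] by (simp add: algebra_simps)
  qed simp
  show ?thesis
  proof (cases "t \<ge> 0")
    case True
    then show ?thesis using nat[of j "nat t"] by simp
  next
    case False
    then show ?thesis using nat[of "j + t * q" "nat (- t)"] by simp
  qed
qed

text \<open>
  With the common period \<open>q * r\<close> every coordinate can be moved into the half-line where the two
  points agree.
\<close>

lemma periodic_eqI:
  fixes x z :: "'a config"
  assumes "q > 0" "translate q x = x" "r > 0" "translate r z = z"
    and agree: "(\<forall>j\<le>0. x j = z j) \<or> (\<forall>j\<ge>0. x j = z j)"
  shows "x = z"
proof
  fix j
  have per: "x (j + t * (q * r)) = x j" "z (j + t * (q * r)) = z j" for t
    using translate_period_multiple[OF assms(2), of j "t * r"]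
      translate_period_multiple[OF assms(4), of j "t * q"]
    by (simp_all add: algebra_simps)
  have "q * r \<ge> 1" using assms(1,3) by (simp add: int_one_le_iff_zero_less)
  then have "\<bar>j\<bar> * (q * r) \<ge> \<bar>j\<bar>" using mult_left_mono[of 1 "q * r" "\<bar>j\<bar>"] by simp
  then have "j + (- \<bar>j\<bar>) * (q * r) \<le> 0" "j + \<bar>j\<bar> * (q * r) \<ge> 0" by linarith+
  then show "x j = z j" using agree per by metis
qed

text \<open>
  Here finiteness of the fibre is decisive. Two points \<open>x\<close>, \<open>z\<close> of the fibre with the same symbol
  at \<open>0\<close> are glued to a point that again lies in the fibre and is therefore periodic. It shares
  its past with \<open>x\<close> and its future with \<open>z\<close>, so it equals both.
\<close>

lemma finite_fibre_inj:
  assumes "one_step X" "finite {x \<in> X. f \<circ> x = y}" "translate p y = y" "p > 0"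
  shows "inj_on (\<lambda>x. x 0) {x \<in> X. f \<circ> x = y}"
proof (rule inj_onI)
  fix x z assume x: "x \<in> {x \<in> X. f \<circ> x = y}" and z: "z \<in> {x \<in> X. f \<circ> x = y}" and eq: "x 0 = z 0"
  let ?u = "glue x z"
  have "?u \<in> X" using one_step_glue[OF assms(1)] x z eq by blast
  moreover have "f \<circ> ?u = y" using x z by (auto simp: glue_def fun_eq_iff)
  ultimately obtain q where q: "q > 0" "translate q ?u = ?u"
    using finite_fibre_periodic[OF assms] by blast
  obtain q1 where q1: "q1 > 0" "translate q1 x = x" using finite_fibre_periodic[OF assms] x by blast
  obtain q2 where q2: "q2 > 0" "translate q2 z = z" using finite_fibre_periodic[OF assms] z by blast
  have "?u = x" by (rule periodic_eqI[OF q q1]) (simp add: glue_def)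
  moreover have "?u = z" by (rule periodic_eqI[OF q q2]) (use eq in \<open>auto simp: glue_def\<close>)
  ultimately show "x = z" by simp
qed

text \<open>
  In the block \<open>w u w\<close> the word \<open>w\<close> is the content of the window and \<open>p\<close> is the length of \<open>w u\<close>;
  the bound on \<open>p\<close> says that the two occurrences do not overlap.
\<close>

lemma recurring_window:
  assumes tr: "\<forall>y\<in>Y. \<forall>k. translate k y \<in> Y" and "irreducible_shift Y" "y \<in> Y"
  obtains y' p where "y' \<in> Y" "p > int m + int n"
    "\<And>j. - int m \<le> j \<Longrightarrow> j \<le> int n \<Longrightarrow> y' j = y j \<and> y' (p + j) = y j"
proof -
  define w where "w = map (\<lambda>k. y (int k - int m)) [0..<m + n + 1]"
  have len: "length w = m + n + 1" by (simp add: w_def)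
  have nth: "w ! k = y (int k - int m)" if "k < m + n + 1" for k
    using that by (simp add: w_def del: upt_Suc)
  have "w \<in> blocks Y"
    unfolding in_blocks_iff[OF tr] using tr assms(3) nth len
    by (intro bexI[of _ "translate (- int m) y"]) (simp_all, simp_all add: translate_def)
  then obtain u where "w @ u @ w \<in> blocks Y" using assms(2) unfolding irreducible_shift_def by blast
  then obtain y1 where y1: "y1 \<in> Y"
      "\<And>k. k < length (w @ u @ w) \<Longrightarrow> y1 (int k) = (w @ u @ w) ! k"
    unfolding in_blocks_iff[OF tr] by blast
  define p where "p = int (length w + length u)"
  have "translate (int m) y1 j = y j \<and> translate (int m) y1 (p + j) = y j"
    if "- int m \<le> j" "j \<le> int n" for j
  proof -
    define k where "k = nat (j + int m)"
    have k: "k < m + n + 1" "j = int k - int m" using that unfolding k_def by auto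
    have "y1 (int k) = w ! k" using y1(2)[of k] k(1) by (simp add: len nth_append)
    moreover have "y1 (int (length w + length u + k)) = w ! k"
      using y1(2)[of "length w + length u + k"] k(1) by (simp add: len nth_append)
    moreover have "j + int m = int k" "p + j + int m = int (length w + length u + k)"
      using k(2) by (simp_all add: p_def)
    ultimately show ?thesis
      unfolding translate_def using nth[OF k(1)] k(2) by (simp only:)
  qed
  moreover have "p > int m + int n" by (simp add: p_def len)
  ultimately show ?thesis using that[of "translate (int m) y1" p] tr y1(1) by blast
qed

text \<open>
  The symbols \<open>D\<close> seen through a smallest window can be continued over \<open>w u\<close> back into \<open>D\<close>, and
  so the periodic point with period \<open>w u\<close> has a lift. Its fibre embeds into \<open>D\<close>.
\<close>

lemma fibre_le_smallest_window:
  assumes "one_step X" "finite (alphabet X)" "Y = (\<circ>) f ` X" "irreducible_shift Y"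
    and fin: "\<And>y. y \<in> Y \<Longrightarrow> finite {x \<in> X. f \<circ> x = y}"
    and "y\<^sub>0 \<in> Y"
    and least: "\<And>y m' n'. y \<in> Y \<Longrightarrow>
      card (window_symbols f X y\<^sub>0 m n) \<le> card (window_symbols f X y m' n')"
  shows "\<exists>y\<in>Y. card {x \<in> X. f \<circ> x = y} \<le> card (window_symbols f X y\<^sub>0 m n)"
proof -
  let ?D = "window_symbols f X y\<^sub>0 m n"
  note tr = one_step_translate[OF assms(1)]
  have trY: "translate k y \<in> Y" if "y \<in> Y" for k y
    using translate_in_image[OF assms(1)] that assms(3) by blast
  have inv: "\<forall>y\<in>Y. \<forall>k. translate k y \<in> Y" using trY by blast
  obtain y\<^sub>1 p where y\<^sub>1: "y\<^sub>1 \<in> Y" and p: "p > int m + int n"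
    and rec: "\<And>j. - int m \<le> j \<Longrightarrow> j \<le> int n \<Longrightarrow> y\<^sub>1 j = y\<^sub>0 j \<and> y\<^sub>1 (p + j) = y\<^sub>0 j"
    using recurring_window[OF inv assms(4,6), where m = m and n = n] by blast
  have finD: "finite ?D" by (rule finite_window_symbols[OF assms(2)])
  have sub: "window_symbols f X y\<^sub>1 m (n + nat p) \<subseteq> ?D"
    using window_symbols_antimono[of m m n "n + nat p" f X y\<^sub>1]
      window_symbols_cong[of m n y\<^sub>1 y\<^sub>0 f X] rec by simp
  \<comment> \<open>This window sees the whole of \<open>w u w\<close>, so it shows no more symbols than \<open>w\<close> alone;
    by minimality it shows no fewer.\<close>
  have D: "window_symbols f X y\<^sub>1 m (n + nat p) = ?D"
    by (rule card_subset_eq[OF finD sub]) (intro antisym card_mono finD sub least y\<^sub>1)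
  have "\<forall>a\<in>?D. \<exists>x. x \<in> X \<and> x 0 = a \<and>
      (\<forall>j. - int m \<le> j \<and> j \<le> int n + p \<longrightarrow> f (x j) = y\<^sub>1 j)"
    using p unfolding D[symmetric] by (auto simp: window_symbols_def)
  from bchoice[OF this] obtain l where l: "\<And>a. a \<in> ?D \<Longrightarrow> l a \<in> X" "\<And>a. a \<in> ?D \<Longrightarrow> l a 0 = a"
      "\<And>a j. a \<in> ?D \<Longrightarrow> - int m \<le> j \<Longrightarrow> j \<le> int n + p \<Longrightarrow> f (l a j) = y\<^sub>1 j"
    by blast
  \<comment> \<open>The lift \<open>l a\<close> passes through \<open>a\<close> at \<open>0\<close>; at the second occurrence of \<open>w\<close> it is again
    in \<open>D\<close>, so \<open>a \<mapsto> l a p\<close> is a self-map of \<open>D\<close> that can be iterated.\<close>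
  have "(\<lambda>a. l a p) ` ?D \<subseteq> ?D"
  proof (rule image_subsetI)
    fix a assume a: "a \<in> ?D"
    have "f (translate p (l a) j) = y\<^sub>0 j" if "- int m \<le> j" "j \<le> int n" for j
      using l(3)[OF a, of "j + p"] rec[OF that] that p by (simp add: translate_def add.commute)
    then have "translate p (l a) 0 \<in> ?D"
      using tr[OF l(1)[OF a]] unfolding window_symbols_def by blast
    then show "l a p \<in> ?D" by (simp add: translate_def)
  qed
  moreover have "?D \<noteq> {}" using window_symbols_nonempty assms(3,6) by blast
  ultimately obtain s :: "int \<Rightarrow> 'a"
    where s: "range s \<subseteq> ?D" "\<And>i. s (i + 1) = l (s i) p"
    using two_sided_orbit[OF finD] by blast
  \<comment> \<open>Segment number \<open>i\<close> of \<open>x\<close> is the lift through \<open>s i\<close>; it ends at \<open>s (i + 1)\<close>, where the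
    next one starts.\<close>
  define x where "x j = l (s (j div p)) (j mod p)" for j
  have p0: "p > 0" using p by simp
  obtain W where W: "X = {x. \<forall>i. [x i, x (i + 1)] \<in> W}"
    using assms(1) unfolding one_step_def by blast
  have "[x j, x (j + 1)] \<in> W" for j
  proof -
    have "l (s (j div p)) \<in> X" using l(1) s(1) by blast
    then have edge: "[x j, l (s (j div p)) (j mod p + 1)] \<in> W"
      using W unfolding x_def by blast
    have split: "j + 1 = (j mod p + 1) + (j div p) * p" by simp
    show ?thesis
    proof (cases "j mod p + 1 = p")
      case True
      then have "j + 1 = (j div p + 1) * p" using split by (simp add: algebra_simps)
      then have "(j + 1) div p = j div p + 1" "(j + 1) mod p = 0" using p0 by simp_all
      then have "x (j + 1) = s (j div p + 1)" using l(2) s(1) by (simp add: x_def range_subsetD)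
      then show ?thesis using edge True s(2) by simp
    next
      case False
      then have "0 \<le> j mod p + 1" "j mod p + 1 < p"
        using p0 pos_mod_sign[of p j] pos_mod_bound[of p j] by linarith+
      then have "((j mod p + 1) + (j div p) * p) div p = j div p"
          "((j mod p + 1) + (j div p) * p) mod p = j mod p + 1"
        using p0 by (simp_all only: div_mult_self1 mod_mult_self1 div_pos_pos_trivial
            mod_pos_pos_trivial less_imp_neq[THEN not_sym] add_0_right not_False_eq_True)
      then have "(j + 1) div p = j div p" "(j + 1) mod p = j mod p + 1"
        by (simp_all only: split[symmetric])
      then show ?thesis using edge by (simp add: x_def)
    qed
  qed
  then have x: "x \<in> X" using W by blast
  define y where "y = f \<circ> x"
  have y: "y j = y\<^sub>1 (j mod p)" for j
  proof -
    have "- int m \<le> j mod p" "j mod p \<le> int n + p"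
      using p0 pos_mod_sign[of p j] pos_mod_bound[of p j] by linarith+
    then show ?thesis using l(3)[of "s (j div p)" "j mod p"] s(1) by (auto simp: y_def x_def)
  qed
  have yY: "y \<in> Y" using x assms(3) by (simp add: y_def)
  have "translate p y = y" by (simp add: translate_def fun_eq_iff y)
  then have inj: "inj_on (\<lambda>x. x 0) {x \<in> X. f \<circ> x = y}"
    using finite_fibre_inj[OF assms(1) fin[OF yY] _ p0] by blast
  \<comment> \<open>The periodic point \<open>y\<close> repeats \<open>y\<^sub>1\<close> on \<open>[0, p)\<close>: nonnegative coordinates of the
    window come from the first occurrence of \<open>w\<close>, negative ones from the second.\<close>
  have "y j = y\<^sub>0 j" if j: "- int m \<le> j" "j \<le> int n" for j
  proof (cases "j \<ge> 0")
    case True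
    then show ?thesis using rec[OF j] j p by (simp add: y)
  next
    case False
    then have "(p + j) mod p = p + j" using j p by (intro mod_pos_pos_trivial) auto
    then have "j mod p = p + j" by simp
    then show ?thesis using rec[OF j] by (simp add: y)
  qed
  then have "(\<lambda>x. x 0) ` {x \<in> X. f \<circ> x = y} \<subseteq> ?D"
    unfolding window_symbols_def by auto
  then have "card {x \<in> X. f \<circ> x = y} \<le> card ?D"
    by (rule card_inj_on_le[OF inj _ finD])
  then show ?thesis using yY by blast
qed

section \<open>The degree formula\<close>

theorem theorem3p1:
  fixes X :: "'a config set" and Y :: "'b config set"
    and \<pi> :: "'a config \<Rightarrow> 'b config" and \<pi>b :: "'a \<Rightarrow> 'b"
  assumes "shift_of_finite_type X" and "one_step X"
    and "sofic Y" and "irreducible_shift Y"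
    and "factor_code \<pi> X Y" and "one_block_code \<pi>b \<pi> X" and "finite_to_one \<pi> X Y"
  shows "degree \<pi> X Y =
    Inf {card (A \<inter> A') | A A'.
      A \<in> forward_reachable \<pi>b X Y \<and> A' \<in> backward_reachable \<pi>b X Y \<and> A \<inter> A' \<noteq> {}}"
proof -
  have \<pi>: "\<pi> x = \<pi>b \<circ> x" if "x \<in> X" for x
    using assms(6) that unfolding one_block_code_def by (simp add: fun_eq_iff)
  have Y: "Y = (\<circ>) \<pi>b ` X"
    using assms(5) \<pi> unfolding factor_code_def by (metis (no_types, lifting) image_cong)
  have fibre: "point_fibre \<pi> X y = {x \<in> X. \<pi>b \<circ> x = y}" for y
    using \<pi> unfolding point_fibre_def by auto
  obtain \<Sigma> where "finite \<Sigma>" "\<forall>x\<in>X. range x \<subseteq> \<Sigma>"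
    using assms(1) unfolding shift_of_finite_type_def by blast
  then have alph: "finite (alphabet X)"
    unfolding alphabet_def by (meson UN_least finite_subset)
  have fin: "finite {x \<in> X. \<pi>b \<circ> x = y}" if "y \<in> Y" for y
    using assms(7) that unfolding finite_to_one_def fibre by blast
  define F where "F = {card {x \<in> X. \<pi>b \<circ> x = y} | y. y \<in> Y}"
  define C where "C = {card (window_symbols \<pi>b X y m n) | y m n. y \<in> Y}"
  \<comment> \<open>For empty \<open>Y\<close> both sides are the infimum of the empty set.\<close>
  have "Inf F = Inf C"
  proof (cases "Y = {}")
    case True
    then show ?thesis by (simp add: F_def C_def)
  next
    case False
    show ?thesis
    proof (rule antisym)
      have "C \<noteq> {}" using False unfolding C_def by blast
      then have "Inf C \<in> C" by (rule Inf_nat_def1)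
      then obtain y\<^sub>0 m n where y\<^sub>0: "y\<^sub>0 \<in> Y" "Inf C = card (window_symbols \<pi>b X y\<^sub>0 m n)"
        unfolding C_def by blast
      have least: "Inf C \<le> card (window_symbols \<pi>b X y m' n')" if "y \<in> Y" for y m' n'
        using that by (intro wellorder_Inf_le1) (auto simp: C_def)
      have "\<exists>y\<in>Y. card {x \<in> X. \<pi>b \<circ> x = y} \<le> card (window_symbols \<pi>b X y\<^sub>0 m n)"
        by (rule fibre_le_smallest_window[OF assms(2) alph Y assms(4) _ y\<^sub>0(1)])
          (erule fin, erule least[unfolded y\<^sub>0(2)])
      then obtain y where y: "y \<in> Y" "card {x \<in> X. \<pi>b \<circ> x = y} \<le> Inf C"
        unfolding y\<^sub>0(2) by blast
      have "Inf F \<le> card {x \<in> X. \<pi>b \<circ> x = y}"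
        using y(1) by (intro wellorder_Inf_le1) (auto simp: F_def)
      then show "Inf F \<le> Inf C" using y(2) by linarith
    next
      have "F \<noteq> {}" using False unfolding F_def by blast
      then have "Inf F \<in> F" by (rule Inf_nat_def1)
      then obtain y where y: "y \<in> Y" "Inf F = card {x \<in> X. \<pi>b \<circ> x = y}"
        unfolding F_def by blast
      obtain n where n: "card (window_symbols \<pi>b X y n n) \<le> Inf F"
        using window_symbols_le_fibre[OF assms(2) alph fin[OF y(1)]] unfolding y(2) by blast
      have "Inf C \<le> card (window_symbols \<pi>b X y n n)"
        using y(1) by (intro wellorder_Inf_le1) (auto simp: C_def)
      then show "Inf C \<le> Inf F" using n by linarith
    qed
  qed
  moreover have "degree \<pi> X Y = Inf F"
    unfolding degree_def fibre F_def by (rule arg_cong[where f = Inf]) blast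
  ultimately show ?thesis
    unfolding reachable_intersections_eq[OF assms(2) Y] C_def by simp
qed

end
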